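(* Let $A$ be an h-separable algebra over a field $\Bbbk$. Then either $A=\Bbbk$ (i.e. the unit map $\Bbbk\to A$ is an isomorphism) or $A=0$.
   Context: A functor $F:\mathcal{B}\to\mathcal{A}$ is h-separable (heavily separable) if there are maps $P_{X,Y}:\mathrm{Hom}_{\mathcal{A}}(FX,FY)\to\mathrm{Hom}_{\mathcal{B}}(X,Y)$, natural in $X,Y\in\mathcal{B}$, such that $P_{X,Y}(Ff)=f$ for every $f:X\to Y$ in $\mathcal{B}$, and $P_{X,Z}(f\circ g)=P_{Y,Z}(f)\circ P_{X,Y}(g)$ for all $X,Y,Z\in\mathcal{B}$ and all $g:FX\to FY$, $f:FY\to FZ$ in $\mathcal{A}$. Algebras are associative and unital, not necessarily commutative or finite-dimensional. A $\Bbbk$-algebra $A$ with unit map $u:\Bbbk\to A$ is h-separable over $\Bbbk$ if the restriction of scalars functor $u_{\ast}:A\text{-}\mathrm{Mod}\to\Bbbk\text{-}\mathrm{Mod}$ (left modules) is h-separable. *)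

theory Defs
  imports "HOL-Algebra.Module" "HOL-Algebra.QuotRing"
begin

section \<open>Categories, functors and h-separability\<close>

text \<open>
  Arrows do not carry their source and target, so composition takes the three objects as
  arguments: \<open>Comp C X Y Z f g\<close> is \<open>f\<close> after \<open>g\<close> for \<open>g : X \<rightarrow> Y\<close> and \<open>f : Y \<rightarrow> Z\<close>.
\<close>

record ('o, 'f) cat =
  Ob :: "'o set"
  Hom :: "'o \<Rightarrow> 'o \<Rightarrow> 'f set"
  Id :: "'o \<Rightarrow> 'f"
  Comp :: "'o \<Rightarrow> 'o \<Rightarrow> 'o \<Rightarrow> 'f \<Rightarrow> 'f \<Rightarrow> 'f"

locale is_cat =
  fixes C :: "('o, 'f) cat"
  assumes Id_in_Hom: "X \<in> Ob C \<Longrightarrow> Id C X \<in> Hom C X X"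
    and Comp_in_Hom:
      "\<lbrakk>X \<in> Ob C; Y \<in> Ob C; Z \<in> Ob C; g \<in> Hom C X Y; f \<in> Hom C Y Z\<rbrakk>
        \<Longrightarrow> Comp C X Y Z f g \<in> Hom C X Z"
    and Comp_Id: "\<lbrakk>X \<in> Ob C; Y \<in> Ob C; f \<in> Hom C X Y\<rbrakk> \<Longrightarrow> Comp C X X Y f (Id C X) = f"
    and Id_Comp: "\<lbrakk>X \<in> Ob C; Y \<in> Ob C; f \<in> Hom C X Y\<rbrakk> \<Longrightarrow> Comp C X Y Y (Id C Y) f = f"
    and Comp_assoc:
      "\<lbrakk>W \<in> Ob C; X \<in> Ob C; Y \<in> Ob C; Z \<in> Ob C;
        h \<in> Hom C W X; g \<in> Hom C X Y; f \<in> Hom C Y Z\<rbrakk>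
        \<Longrightarrow> Comp C W Y Z f (Comp C W X Y g h) = Comp C W X Z (Comp C X Y Z f g) h"

record ('o, 'f, 'p, 'g) func =
  obj_map :: "'o \<Rightarrow> 'p"
  arr_map :: "'o \<Rightarrow> 'o \<Rightarrow> 'f \<Rightarrow> 'g"

locale is_func = B: is_cat B + A: is_cat A
  for B :: "('o, 'f) cat" and A :: "('p, 'g) cat" +
  fixes F :: "('o, 'f, 'p, 'g) func"
  assumes obj_map_Ob: "X \<in> Ob B \<Longrightarrow> obj_map F X \<in> Ob A"
    and arr_map_Hom:
      "\<lbrakk>X \<in> Ob B; Y \<in> Ob B; f \<in> Hom B X Y\<rbrakk>
        \<Longrightarrow> arr_map F X Y f \<in> Hom A (obj_map F X) (obj_map F Y)"
    and arr_map_Id: "X \<in> Ob B \<Longrightarrow> arr_map F X X (Id B X) = Id A (obj_map F X)"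
    and arr_map_Comp:
      "\<lbrakk>X \<in> Ob B; Y \<in> Ob B; Z \<in> Ob B; g \<in> Hom B X Y; f \<in> Hom B Y Z\<rbrakk>
        \<Longrightarrow> arr_map F X Z (Comp B X Y Z f g)
          = Comp A (obj_map F X) (obj_map F Y) (obj_map F Z) (arr_map F Y Z f) (arr_map F X Y g)"

text \<open>
  The second condition is naturality of \<open>P\<close>, contravariant in \<open>X\<close> and covariant in \<open>Y\<close>:
  \<open>P (F k \<circ> f \<circ> F h) = k \<circ> P f \<circ> h\<close>.
\<close>

definition h_separable_func ::
  "('o, 'f) cat \<Rightarrow> ('p, 'g) cat \<Rightarrow> ('o, 'f, 'p, 'g) func \<Rightarrow> bool" where
  "h_separable_func B A F \<longleftrightarrow> is_func B A F \<and>
    (\<exists>P :: 'o \<Rightarrow> 'o \<Rightarrow> 'g \<Rightarrow> 'f.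
      (\<forall>X\<in>Ob B. \<forall>Y\<in>Ob B. \<forall>f\<in>Hom A (obj_map F X) (obj_map F Y). P X Y f \<in> Hom B X Y) \<and>
      (\<forall>X\<in>Ob B. \<forall>X'\<in>Ob B. \<forall>Y\<in>Ob B. \<forall>Y'\<in>Ob B.
        \<forall>h\<in>Hom B X' X. \<forall>k\<in>Hom B Y Y'. \<forall>f\<in>Hom A (obj_map F X) (obj_map F Y).
          P X' Y' (Comp A (obj_map F X') (obj_map F Y) (obj_map F Y') (arr_map F Y Y' k)
                    (Comp A (obj_map F X') (obj_map F X) (obj_map F Y) f (arr_map F X' X h)))
          = Comp B X' Y Y' k (Comp B X' X Y (P X Y f) h)) \<and>
      (\<forall>X\<in>Ob B. \<forall>Y\<in>Ob B. \<forall>f\<in>Hom B X Y. P X Y (arr_map F X Y f) = f) \<and>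
      (\<forall>X\<in>Ob B. \<forall>Y\<in>Ob B. \<forall>Z\<in>Ob B.
        \<forall>g\<in>Hom A (obj_map F X) (obj_map F Y). \<forall>f\<in>Hom A (obj_map F Y) (obj_map F Z).
          P X Z (Comp A (obj_map F X) (obj_map F Y) (obj_map F Z) f g)
          = Comp B X Y Z (P Y Z f) (P X Y g)))"


section \<open>Left modules and restriction of scalars\<close>

text \<open>The library's locale \<open>module\<close> requires the ring of scalars to be commutative.\<close>

locale left_module = R?: ring R + M?: abelian_group M
  for R (structure) and M :: "('r, 'm, 'c) module_scheme" (structure) +
  assumes smult_closed:
      "\<lbrakk>a \<in> carrier R; x \<in> carrier M\<rbrakk> \<Longrightarrow> a \<odot>\<^bsub>M\<^esub> x \<in> carrier M"
    and smult_l_distr: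
      "\<lbrakk>a \<in> carrier R; b \<in> carrier R; x \<in> carrier M\<rbrakk> \<Longrightarrow>
      (a \<oplus>\<^bsub>R\<^esub> b) \<odot>\<^bsub>M\<^esub> x = a \<odot>\<^bsub>M\<^esub> x \<oplus>\<^bsub>M\<^esub> b \<odot>\<^bsub>M\<^esub> x"
    and smult_r_distr:
      "\<lbrakk>a \<in> carrier R; x \<in> carrier M; y \<in> carrier M\<rbrakk> \<Longrightarrow>
      a \<odot>\<^bsub>M\<^esub> (x \<oplus>\<^bsub>M\<^esub> y) = a \<odot>\<^bsub>M\<^esub> x \<oplus>\<^bsub>M\<^esub> a \<odot>\<^bsub>M\<^esub> y"
    and smult_assoc:
      "\<lbrakk>a \<in> carrier R; b \<in> carrier R; x \<in> carrier M\<rbrakk> \<Longrightarrow>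
      (a \<otimes>\<^bsub>R\<^esub> b) \<odot>\<^bsub>M\<^esub> x = a \<odot>\<^bsub>M\<^esub> (b \<odot>\<^bsub>M\<^esub> x)"
    and smult_one: "x \<in> carrier M \<Longrightarrow> \<one>\<^bsub>R\<^esub> \<odot>\<^bsub>M\<^esub> x = x"

lemma left_module_iff_module: "cring R \<Longrightarrow> left_module R M \<longleftrightarrow> module R M"
  by (auto simp: left_module_def module_def left_module_axioms_def module_axioms_def
      cring.axioms(1))

text \<open>Linear maps are taken extensional, so that equal arrows are equal as HOL functions.\<close>

definition mod_hom ::
  "('r, 'x) ring_scheme \<Rightarrow> ('r, 'm) module \<Rightarrow> ('r, 'm) module \<Rightarrow> ('m \<Rightarrow> 'm) set" where
  "mod_hom R M N = {f \<in> carrier M \<rightarrow>\<^sub>E carrier N.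
    (\<forall>x\<in>carrier M. \<forall>y\<in>carrier M. f (x \<oplus>\<^bsub>M\<^esub> y) = f x \<oplus>\<^bsub>N\<^esub> f y) \<and>
    (\<forall>a\<in>carrier R. \<forall>x\<in>carrier M. f (a \<odot>\<^bsub>M\<^esub> x) = a \<odot>\<^bsub>N\<^esub> f x)}"

text \<open>
  The category of left \<open>R\<close>-modules whose underlying set is a subset of the type \<open>'m\<close>; this type
  plays the role of the universe.  The fields \<open>mult\<close> and \<open>one\<close> of the module record are
  irrelevant.
\<close>

definition Mod_cat :: "('r, 'x) ring_scheme \<Rightarrow> (('r, 'm) module, 'm \<Rightarrow> 'm) cat" where
  "Mod_cat R = \<lparr>
    Ob = {M. left_module R M},
    Hom = mod_hom R,
    Id = (\<lambda>M. restrict id (carrier M)),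
    Comp = (\<lambda>X Y Z f g. compose (carrier X) f g)\<rparr>"

definition restrict_scalars :: "('k \<Rightarrow> 'a) \<Rightarrow> ('a, 'm) module \<Rightarrow> ('k, 'm) module" where
  "restrict_scalars u M = \<lparr>carrier = carrier M, mult = mult M, one = one M,
    zero = zero M, add = add M, smult = (\<lambda>c x. u c \<odot>\<^bsub>M\<^esub> x)\<rparr>"

definition restriction_func ::
  "('k \<Rightarrow> 'a) \<Rightarrow> (('a, 'm) module, 'm \<Rightarrow> 'm, ('k, 'm) module, 'm \<Rightarrow> 'm) func" where
  "restriction_func u = \<lparr>obj_map = restrict_scalars u, arr_map = (\<lambda>X Y f. f)\<rparr>"

lemma left_module_add_closed:
  "\<lbrakk>left_module R M; x \<in> carrier M; y \<in> carrier M\<rbrakk> \<Longrightarrow> x \<oplus>\<^bsub>M\<^esub> y \<in> carrier M"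
  by (simp add: left_module_def abelian_group_def abelian_monoid.a_closed)

lemma mod_hom_compose:
  assumes X: "left_module R X" and g: "g \<in> mod_hom R X Y" and f: "f \<in> mod_hom R Y Z"
  shows "compose (carrier X) f g \<in> mod_hom R X Z"
proof -
  have "g x \<in> carrier Y" if "x \<in> carrier X" for x
    using g that by (auto simp: mod_hom_def)
  moreover have "f y \<in> carrier Z" if "y \<in> carrier Y" for y
    using f that by (auto simp: mod_hom_def)
  ultimately show ?thesis
    using f g by (simp add: mod_hom_def compose_def left_module_add_closed [OF X]
        left_module.smult_closed [OF X])
qed

lemma is_cat_Mod_cat: "is_cat (Mod_cat R :: (('r, 'm) module, 'm \<Rightarrow> 'm) cat)"
proof
  fix W X Y Z :: "('r, 'm) module" and f g h
  show "X \<in> Ob (Mod_cat R) \<Longrightarrow> Id (Mod_cat R) X \<in> Hom (Mod_cat R) X X"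
    by (auto simp: Mod_cat_def mod_hom_def left_module_add_closed left_module.smult_closed)
  show "\<lbrakk>X \<in> Ob (Mod_cat R); Y \<in> Ob (Mod_cat R); Z \<in> Ob (Mod_cat R);
      g \<in> Hom (Mod_cat R) X Y; f \<in> Hom (Mod_cat R) Y Z\<rbrakk>
      \<Longrightarrow> Comp (Mod_cat R) X Y Z f g \<in> Hom (Mod_cat R) X Z"
    by (simp add: Mod_cat_def mod_hom_compose)
  show "\<lbrakk>X \<in> Ob (Mod_cat R); Y \<in> Ob (Mod_cat R); f \<in> Hom (Mod_cat R) X Y\<rbrakk>
      \<Longrightarrow> Comp (Mod_cat R) X X Y f (Id (Mod_cat R) X) = f"
    by (auto simp: Mod_cat_def mod_hom_def compose_def fun_eq_iff PiE_def extensional_def)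
  show "\<lbrakk>X \<in> Ob (Mod_cat R); Y \<in> Ob (Mod_cat R); f \<in> Hom (Mod_cat R) X Y\<rbrakk>
      \<Longrightarrow> Comp (Mod_cat R) X Y Y (Id (Mod_cat R) Y) f = f"
    by (auto simp: Mod_cat_def mod_hom_def compose_def fun_eq_iff PiE_def extensional_def)
  show "\<lbrakk>W \<in> Ob (Mod_cat R); X \<in> Ob (Mod_cat R); Y \<in> Ob (Mod_cat R); Z \<in> Ob (Mod_cat R);
      h \<in> Hom (Mod_cat R) W X; g \<in> Hom (Mod_cat R) X Y; f \<in> Hom (Mod_cat R) Y Z\<rbrakk>
      \<Longrightarrow> Comp (Mod_cat R) W Y Z f (Comp (Mod_cat R) W X Y g h)
        = Comp (Mod_cat R) W X Z (Comp (Mod_cat R) X Y Z f g) h"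
    by (auto simp: Mod_cat_def mod_hom_def compose_def fun_eq_iff PiE_mem)
qed

lemma left_module_restrict_scalars:
  assumes K: "ring K" and u: "u \<in> ring_hom K A" and M: "left_module A M"
  shows "left_module K (restrict_scalars u M)"
proof -
  interpret left_module A M by (rule M)
  have "abelian_group (restrict_scalars u M)"
    by (rule abelian_groupI)
      (auto simp: restrict_scalars_def M.a_ac intro: bexI[of _ "\<ominus>\<^bsub>M\<^esub> x" for x] M.l_neg)
  moreover have "left_module_axioms K (restrict_scalars u M)"
    using u by (intro left_module_axioms.intro)
      (auto simp: restrict_scalars_def ring_hom_def Pi_iff smult_closed smult_l_distr
        smult_r_distr smult_assoc smult_one)
  ultimately show ?thesis
    using K by (simp add: left_module_def)
qed

lemma is_func_restriction_func:
  assumes "ring K" "u \<in> ring_hom K A"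
  shows "is_func (Mod_cat A) (Mod_cat K) (restriction_func u)"
proof (intro is_func.intro is_func_axioms.intro is_cat_Mod_cat)
  show "obj_map (restriction_func u) X \<in> Ob (Mod_cat K)" if "X \<in> Ob (Mod_cat A)" for X
    using that left_module_restrict_scalars[OF assms]
    by (simp add: Mod_cat_def restriction_func_def)
qed (use assms(2) in \<open>auto simp: Mod_cat_def restriction_func_def mod_hom_def ring_hom_def Pi_iff
      restrict_scalars_def\<close>)


section \<open>Algebras\<close>

text \<open>The library's locale \<open>algebra\<close> requires the algebra to be commutative.\<close>

locale unital_algebra = module K A + A?: ring A for K (structure) and A (structure) +
  assumes smult_mult_left:
      "\<lbrakk>c \<in> carrier K; x \<in> carrier A; y \<in> carrier A\<rbrakk> \<Longrightarrow>
      (c \<odot>\<^bsub>A\<^esub> x) \<otimes>\<^bsub>A\<^esub> y = c \<odot>\<^bsub>A\<^esub> (x \<otimes>\<^bsub>A\<^esub> y)"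
    and smult_mult_right:
      "\<lbrakk>c \<in> carrier K; x \<in> carrier A; y \<in> carrier A\<rbrakk> \<Longrightarrow>
      x \<otimes>\<^bsub>A\<^esub> (c \<odot>\<^bsub>A\<^esub> y) = c \<odot>\<^bsub>A\<^esub> (x \<otimes>\<^bsub>A\<^esub> y)"

definition unit_map :: "('k, 'a, 'c) module_scheme \<Rightarrow> 'k \<Rightarrow> 'a" where
  "unit_map A c = c \<odot>\<^bsub>A\<^esub> \<one>\<^bsub>A\<^esub>"

lemma (in unital_algebra) unit_map_ring_hom: "unit_map A \<in> ring_hom K A"
  by (rule ring_hom_memI)
    (simp_all add: unit_map_def smult_l_distr smult_assoc1 smult_mult_left)

text \<open>
  HOL cannot quantify over all types inside a formula, so the universe \<open>'m\<close> in which the modules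
  live is a parameter.  Over a universe that is too small (for instance \<open>unit\<close>) the notion is void.
  A type containing an injective copy of the finite lists over \<open>A\<close> is large enough to hold \<open>A\<close>
  and \<open>A \<otimes> A\<close> up to isomorphism when \<open>K\<close> is a field.
\<close>

definition h_separable_algebra ::
  "'m itself \<Rightarrow> ('k, 'x) ring_scheme \<Rightarrow> ('k, 'a, 'c) module_scheme \<Rightarrow> bool" where
  "h_separable_algebra (_ :: 'm itself) K A \<longleftrightarrow>
    unital_algebra K A \<and>
    h_separable_func (Mod_cat A :: (('a, 'm) module, 'm \<Rightarrow> 'm) cat)
      (Mod_cat K :: (('k, 'm) module, 'm \<Rightarrow> 'm) cat)
      (restriction_func (unit_map A))"

end

theory Submission
  imports Defs "HOL-Algebra.Subrings"
begin

text \<open>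
  Fix a \<open>K\<close>-basis \<open>B\<close> of \<open>A\<close> that contains \<open>1\<close>, and let \<open>F = A\<^sup>(\<^sup>B\<^sup>)\<close> be the free left \<open>A\<close>-module on
  it, realised by finitely supported functions from \<open>B\<close> to \<open>A\<close>.  This is \<open>A \<otimes> A\<close> in coordinates
  of the second factor.  Applied to the endomorphisms of the single object \<open>F\<close>, h-separability
  gives a monoid homomorphism \<open>P\<close> from the \<open>K\<close>-linear to the \<open>A\<close>-linear endomorphisms of \<open>F\<close> that
  fixes every \<open>A\<close>-linear one.  When \<open>1 \<noteq> 0\<close>, such a \<open>P\<close> forces \<open>B = {1}\<close>, that is \<open>A = K\<close>.

  Write \<open>\<epsilon>\<close> for the basis vector of \<open>F\<close> at \<open>1 \<in> B\<close>, and \<open>\<phi>\<^sub>b\<close> for the coordinate functionals of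
  \<open>A\<close>, viewed as taking values in \<open>K 1 \<subseteq> A\<close>.  The rank one maps \<open>E\<^sub>b : g \<mapsto> \<phi>\<^sub>b (g 1) \<epsilon>\<close> are
  \<open>K\<close>-linear.

  First, \<open>P\<close> does not kill all of them.  Let \<open>j : F \<rightarrow> F\<close> send \<open>g\<close> to the coordinate family of \<open>g 1\<close>
  (the map \<open>a \<mapsto> 1 \<otimes> a\<close>), and let \<open>m\<close> be the multiplication \<open>g \<mapsto> (\<Sum>b. g b b) \<epsilon>\<close>, which is
  \<open>A\<close>-linear.  Then \<open>m \<circ> j\<close> is the \<open>A\<close>-linear projection \<open>g \<mapsto> g 1 \<epsilon>\<close>, so \<open>m (P j \<epsilon>) = \<epsilon>\<close> and the
  element \<open>P j \<epsilon>\<close>, the separability idempotent, is not zero.  Its coefficient at \<open>b\<close> is the value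
  of \<open>P E\<^sub>b\<close> at \<open>\<epsilon>\<close>.  Hence \<open>P E\<^sub>b \<noteq> 0\<close> for some \<open>b\<close>.  Since \<open>E\<^sub>b\<close> factors through every other
  \<open>E\<^sub>c\<close>, it follows that \<open>P E\<^sub>c \<noteq> 0\<close> for every \<open>c \<in> B\<close>.

  Second, suppose that \<open>c \<in> B\<close> and \<open>c \<noteq> 1\<close>.  Put \<open>f = E\<^sub>c\<close> and \<open>T = P f\<close>.  Then \<open>f \<circ> f = 0\<close>, because
  \<open>\<phi>\<^sub>c 1 = 0\<close>, and therefore \<open>T \<circ> T = 0\<close>.  The map \<open>T\<close> is right multiplication by some \<open>x \<noteq> 0\<close> on the
  coordinate at \<open>1\<close>, so \<open>x\<^sup>2 = 0\<close> and \<open>x\<close> is not a scalar.  So \<open>\<phi>\<^sub>d x \<noteq> 0\<close> for some \<open>d \<noteq> 1\<close>, and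
  then \<open>f\<close> can be recovered as \<open>E \<circ> T \<circ> f\<close> with a multiple \<open>E\<close> of \<open>E\<^sub>d\<close>.  Applying \<open>P\<close> yields
  \<open>T = P E \<circ> T \<circ> T = 0\<close>, a contradiction.  This is \<open>trivial_of_endomorphism_retraction\<close>.

  The remaining work is the existence of bases over a subfield (\<open>left_basis_exists\<close>, by Zorn's
  lemma) and the passage from \<open>F\<close>, whose elements are functions, to a module inside the given
  universe: finitely supported functions are coded by lists (\<open>fin_supp_encoding\<close>), and the module
  structure is carried along this injection (\<open>h_separable_endomorphism_retraction\<close>).
\<close>

section \<open>Finitely supported coefficient families\<close>

context ring
begin

text \<open>
  Two coefficient sets matter: \<open>k = carrier R\<close> gives the free \<open>R\<close>-module on \<open>B\<close>, and a subfield
  \<open>k\<close> gives the coordinate space of \<open>R\<close> with respect to a \<open>k\<close>-basis \<open>B\<close>, which then sits inside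
  the free module.
\<close>

definition fin_supp :: "'a set \<Rightarrow> 'i set \<Rightarrow> ('i \<Rightarrow> 'a) set" where
  "fin_supp k B = {g. (\<forall>b. g b \<in> k) \<and> (\<forall>b. b \<notin> B \<longrightarrow> g b = \<zero>) \<and> finite {b. g b \<noteq> \<zero>}}"

definition single :: "'i \<Rightarrow> 'a \<Rightarrow> 'i \<Rightarrow> 'a" where
  "single b a = (\<lambda>x. if x = b then a else \<zero>)"

text \<open>
  On families indexed by elements of \<open>R\<close>, this is the multiplication \<open>R \<otimes> R \<rightarrow> R\<close> when the family
  lists the left factors, and the expansion in a basis when its values are scalars.
\<close>

definition lincomb :: "('a \<Rightarrow> 'a) \<Rightarrow> 'a" where
  "lincomb g = (\<Oplus>b\<in>{b. g b \<noteq> \<zero>}. g b \<otimes> b)"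

lemma fin_suppD:
  assumes "g \<in> fin_supp k B"
  shows "g b \<in> k" "b \<notin> B \<Longrightarrow> g b = \<zero>" "finite {b. g b \<noteq> \<zero>}" "{b. g b \<noteq> \<zero>} \<subseteq> B"
  using assms by (auto simp: fin_supp_def)

lemma fin_supp_mono: "k \<subseteq> k' \<Longrightarrow> B \<subseteq> B' \<Longrightarrow> fin_supp k B \<subseteq> fin_supp k' B'"
  by (auto simp: fin_supp_def)

lemma zero_in_fin_supp: "\<zero> \<in> k \<Longrightarrow> (\<lambda>_. \<zero>) \<in> fin_supp k B"
  by (simp add: fin_supp_def)

lemma single_in_fin_supp: "a \<in> k \<Longrightarrow> \<zero> \<in> k \<Longrightarrow> b \<in> B \<Longrightarrow> single b a \<in> fin_supp k B"
  by (auto simp: fin_supp_def single_def)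

lemma add_in_fin_supp:
  assumes "subring k R" "g \<in> fin_supp k B" "h \<in> fin_supp k B"
  shows "(\<lambda>b. g b \<oplus> h b) \<in> fin_supp k B"
proof -
  have "{b. g b \<oplus> h b \<noteq> \<zero>} \<subseteq> {b. g b \<noteq> \<zero>} \<union> {b. h b \<noteq> \<zero>}" by auto
  then have "finite {b. g b \<oplus> h b \<noteq> \<zero>}"
    by (rule finite_subset) (use fin_suppD(3)[OF assms(2)] fin_suppD(3)[OF assms(3)] in simp)
  then show ?thesis
    using assms subringE(7)[OF assms(1)] by (auto simp: fin_supp_def)
qed

lemma smult_in_fin_supp:
  assumes "subring k R" "a \<in> k" "g \<in> fin_supp k B"
  shows "(\<lambda>b. a \<otimes> g b) \<in> fin_supp k B"
proof -
  have a: "a \<in> carrier R"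
    using assms(2) subringE(1)[OF assms(1)] by auto
  then have "{b. a \<otimes> g b \<noteq> \<zero>} \<subseteq> {b. g b \<noteq> \<zero>}" by auto
  then have "finite {b. a \<otimes> g b \<noteq> \<zero>}"
    using fin_suppD(3)[OF assms(3)] by (rule finite_subset)
  then show ?thesis
    using assms a subringE(6)[OF assms(1)] by (auto simp: fin_supp_def)
qed

lemma lincomb_superset:
  assumes "g \<in> fin_supp (carrier R) B" "B \<subseteq> carrier R"
    and "finite S" "{b. g b \<noteq> \<zero>} \<subseteq> S" "S \<subseteq> carrier R"
  shows "lincomb g = (\<Oplus>b\<in>S. g b \<otimes> b)"
  unfolding lincomb_def
  by (rule add.finprod_mono_neutral_cong_left)
    (use assms fin_suppD(1)[OF assms(1)] in auto)

lemma lincomb_closed: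
  assumes "g \<in> fin_supp (carrier R) B" "B \<subseteq> carrier R"
  shows "lincomb g \<in> carrier R"
  unfolding lincomb_def
  by (rule finsum_closed) (use assms fin_suppD(1,4)[OF assms(1)] in auto)

lemma lincomb_add:
  assumes g: "g \<in> fin_supp (carrier R) B" and h: "h \<in> fin_supp (carrier R) B"
    and B: "B \<subseteq> carrier R"
  shows "lincomb (\<lambda>b. g b \<oplus> h b) = lincomb g \<oplus> lincomb h"
proof -
  let ?S = "{b. g b \<noteq> \<zero>} \<union> {b. h b \<noteq> \<zero>}"
  have S: "finite ?S" "?S \<subseteq> carrier R"
    using fin_suppD(3,4)[OF g] fin_suppD(3,4)[OF h] B by auto
  have gh: "(\<lambda>b. g b \<oplus> h b) \<in> fin_supp (carrier R) B"
    using g h carrier_is_subring by (intro add_in_fin_supp)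
  have "lincomb (\<lambda>b. g b \<oplus> h b) = (\<Oplus>b\<in>?S. (g b \<oplus> h b) \<otimes> b)"
    by (rule lincomb_superset[OF gh B]) (use S in auto)
  also have "\<dots> = (\<Oplus>b\<in>?S. g b \<otimes> b \<oplus> h b \<otimes> b)"
    by (rule finsum_cong') (use S fin_suppD(1)[OF g] fin_suppD(1)[OF h] in \<open>auto simp: l_distr\<close>)
  also have "\<dots> = (\<Oplus>b\<in>?S. g b \<otimes> b) \<oplus> (\<Oplus>b\<in>?S. h b \<otimes> b)"
    by (rule finsum_addf) (use S fin_suppD(1)[OF g] fin_suppD(1)[OF h] in auto)
  also have "(\<Oplus>b\<in>?S. g b \<otimes> b) = lincomb g"
    by (rule lincomb_superset[OF g B, symmetric]) (use S in auto)
  also have "(\<Oplus>b\<in>?S. h b \<otimes> b) = lincomb h"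
    by (rule lincomb_superset[OF h B, symmetric]) (use S in auto)
  finally show ?thesis .
qed

lemma lincomb_smult:
  assumes g: "g \<in> fin_supp (carrier R) B" and B: "B \<subseteq> carrier R" and a: "a \<in> carrier R"
  shows "lincomb (\<lambda>b. a \<otimes> g b) = a \<otimes> lincomb g"
proof -
  let ?S = "{b. g b \<noteq> \<zero>}"
  have S: "finite ?S" "?S \<subseteq> carrier R"
    using fin_suppD(3,4)[OF g] B by auto
  have ag: "(\<lambda>b. a \<otimes> g b) \<in> fin_supp (carrier R) B"
    using g a carrier_is_subring by (intro smult_in_fin_supp)
  have "lincomb (\<lambda>b. a \<otimes> g b) = (\<Oplus>b\<in>?S. (a \<otimes> g b) \<otimes> b)"
    by (rule lincomb_superset[OF ag B]) (use S a in auto)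
  also have "\<dots> = (\<Oplus>b\<in>?S. a \<otimes> (g b \<otimes> b))"
    by (rule finsum_cong') (use S a fin_suppD(1)[OF g] in \<open>auto simp: m_assoc\<close>)
  also have "\<dots> = a \<otimes> lincomb g"
    unfolding lincomb_def
    by (rule finsum_rdistr[symmetric]) (use S a fin_suppD(1)[OF g] in auto)
  finally show ?thesis .
qed

lemma lincomb_zero: "lincomb (\<lambda>_. \<zero>) = \<zero>"
  by (simp add: lincomb_def)

lemma lincomb_single:
  assumes "a \<in> carrier R" "b \<in> carrier R"
  shows "lincomb (single b a) = a \<otimes> b"
proof -
  have "lincomb (single b a) = (\<Oplus>x\<in>{b}. single b a x \<otimes> x)"
    by (rule lincomb_superset[where B = "{b}"])
      (use assms single_in_fin_supp[of a "carrier R" b "{b}"] in \<open>auto simp: single_def\<close>)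
  then show ?thesis
    using assms by (simp add: single_def)
qed


section \<open>Bases over a subfield\<close>

definition left_basis :: "'a set \<Rightarrow> 'a set \<Rightarrow> bool" where
  "left_basis k B \<longleftrightarrow> B \<subseteq> carrier R \<and> bij_betw lincomb (fin_supp k B) (carrier R)"

definition left_indep :: "'a set \<Rightarrow> 'a set \<Rightarrow> bool" where
  "left_indep k B \<longleftrightarrow> B \<subseteq> carrier R \<and> (\<forall>g\<in>fin_supp k B. lincomb g = \<zero> \<longrightarrow> g = (\<lambda>_. \<zero>))"

text \<open>
  A difference of two families with the same value is a family with value zero.  The difference is
  formed with the scalar \<open>\<ominus> \<one>\<close>, so that closure under sums and scalar multiples is enough.
\<close>

lemma left_indep_inj_on_lincomb:
  assumes k: "subring k R" and B: "left_indep k B"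
  shows "inj_on lincomb (fin_supp k B)"
proof (rule inj_onI)
  fix g h assume g: "g \<in> fin_supp k B" and h: "h \<in> fin_supp k B" and eq: "lincomb g = lincomb h"
  have Bc: "B \<subseteq> carrier R" using B by (simp add: left_indep_def)
  have kc: "k \<subseteq> carrier R" using subringE(1)[OF k] .
  have sub: "fin_supp k B \<subseteq> fin_supp (carrier R) B"
    using kc by (rule fin_supp_mono) simp
  let ?n = "\<lambda>b. \<ominus> \<one> \<otimes> h b"
  have m1: "\<ominus> \<one> \<in> k" using subringE(3,5)[OF k] by auto
  have n: "?n \<in> fin_supp k B" using k m1 h by (rule smult_in_fin_supp)
  have "lincomb (\<lambda>b. g b \<oplus> ?n b) = lincomb g \<oplus> lincomb ?n"
    using sub g n Bc by (intro lincomb_add) auto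
  also have "lincomb ?n = \<ominus> \<one> \<otimes> lincomb h"
    using sub h Bc m1 kc by (intro lincomb_smult) auto
  also have "lincomb g \<oplus> \<ominus> \<one> \<otimes> lincomb h = \<zero>"
    using eq lincomb_closed[of h B] sub h Bc by (auto simp: l_minus r_neg)
  finally have "(\<lambda>b. g b \<oplus> ?n b) = (\<lambda>_. \<zero>)"
    using B add_in_fin_supp[OF k g n] by (auto simp: left_indep_def)
  then have 0: "g b \<oplus> \<ominus> \<one> \<otimes> h b = \<zero>" for b by (simp add: fun_eq_iff)
  show "g = h"
  proof
    fix b
    have "g b \<in> carrier R" "h b \<in> carrier R"
      using fin_suppD(1)[OF g] fin_suppD(1)[OF h] kc by auto
    with 0[of b] show "g b = h b"
      using minus_equality[of "g b" "\<ominus> h b"] by (simp add: l_minus)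
  qed
qed

text \<open>
  If \<open>a \<notin> B\<close>, maximality gives a nontrivial relation on \<open>insert a B\<close>.  By independence of \<open>B\<close> the
  coefficient of \<open>a\<close> in it is nonzero, hence invertible in \<open>k\<close>, and the relation can be solved
  for \<open>a\<close>.
\<close>

lemma left_indep_maximal_spans:
  assumes k: "subfield k R" and B: "left_indep k B"
    and max: "\<And>a. a \<in> carrier R \<Longrightarrow> left_indep k (insert a B) \<Longrightarrow> a \<in> B"
    and a: "a \<in> carrier R"
  shows "a \<in> lincomb ` fin_supp k B"
proof (cases "a \<in> B")
  note k' = subfieldE(1)[OF k]
  case True
  then have "single a \<one> \<in> fin_supp k B"
    using subringE(2,3)[OF k'] by (intro single_in_fin_supp)
  moreover have "lincomb (single a \<one>) = a" using a by (simp add: lincomb_single)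
  ultimately show ?thesis by (metis image_eqI)
next
  note k' = subfieldE(1)[OF k]
  have kc: "k \<subseteq> carrier R" using subringE(1)[OF k'] .
  have Bc: "B \<subseteq> carrier R" using B by (simp add: left_indep_def)
  case False
  with max a have "\<not> left_indep k (insert a B)" by blast
  then obtain g where g: "g \<in> fin_supp k (insert a B)" "lincomb g = \<zero>" "g \<noteq> (\<lambda>_. \<zero>)"
    using a Bc by (auto simp: left_indep_def)
  define h where "h = g(a := \<zero>)"
  have h: "h \<in> fin_supp k B"
  proof -
    have "{b. h b \<noteq> \<zero>} \<subseteq> {b. g b \<noteq> \<zero>}" by (auto simp: h_def)
    with fin_suppD(3)[OF g(1)] have "finite {b. h b \<noteq> \<zero>}" by (rule rev_finite_subset)
    then show ?thesis
      using g(1) subringE(2)[OF k'] by (auto simp: fin_supp_def h_def)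
  qed
  have ga0: "g a \<noteq> \<zero>"
  proof
    assume "g a = \<zero>"
    then have "h = g" by (auto simp: h_def)
    with B g h show False by (auto simp: left_indep_def)
  qed
  define c where "c = inv (g a)"
  have gak: "g a \<in> k - {\<zero>}" using ga0 fin_suppD(1)[OF g(1)] by auto
  have c: "c \<in> k" "c \<otimes> g a = \<one>"
    using subfield_m_inv[OF k gak] by (auto simp: c_def)
  have cc: "c \<in> carrier R" "g a \<in> carrier R" using c gak kc by auto
  have g_eq: "g = (\<lambda>b. single a (g a) b \<oplus> h b)"
    using fin_suppD(1)[OF g(1)] kc cc by (auto simp: h_def single_def fun_eq_iff subset_iff)
  have sub: "fin_supp k B \<subseteq> fin_supp (carrier R) (insert a B)"
    using kc by (intro fin_supp_mono) auto
  have hl: "lincomb h \<in> carrier R"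
    by (rule lincomb_closed[where B = "insert a B"]) (use h sub Bc a in auto)
  have "\<zero> = lincomb (single a (g a)) \<oplus> lincomb h"
  proof -
    have "lincomb (\<lambda>b. single a (g a) b \<oplus> h b) = lincomb (single a (g a)) \<oplus> lincomb h"
      by (rule lincomb_add[where B = "insert a B"])
        (use cc sub h Bc a in \<open>auto intro: single_in_fin_supp\<close>)
    with g_eq g(2) show ?thesis by simp
  qed
  then have "g a \<otimes> a \<oplus> lincomb h = \<zero>" using cc a by (simp add: lincomb_single)
  then have "g a \<otimes> a = \<ominus> lincomb h"
    using cc a hl by (simp add: minus_equality)
  then have "a = c \<otimes> \<ominus> lincomb h"
    using cc a c(2) by (metis l_one m_assoc)
  also have "\<dots> = \<ominus> c \<otimes> lincomb h" using cc hl by (simp add: l_minus r_minus)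
  also have "\<dots> = lincomb (\<lambda>b. \<ominus> c \<otimes> h b)"
    by (rule lincomb_smult[symmetric, where B = "insert a B"]) (use sub h Bc a cc in auto)
  finally have "a = lincomb (\<lambda>b. \<ominus> c \<otimes> h b)" .
  moreover have "(\<lambda>b. \<ominus> c \<otimes> h b) \<in> fin_supp k B"
    using k' h subringE(5)[OF k'] c by (intro smult_in_fin_supp) auto
  ultimately show ?thesis by blast
qed

text \<open>
  Zorn's lemma among the independent sets that contain \<open>\<one>\<close>; the set \<open>{\<one>}\<close> is one of them.  Having \<open>\<one>\<close> in the basis makes the other coordinate functionals vanish
  on scalars.
\<close>

lemma left_basis_exists:
  assumes k: "subfield k R"
  obtains B where "left_basis k B" "\<one> \<in> B"
proof -
  note k' = subfieldE(1)[OF k]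
  have kc: "k \<subseteq> carrier R" using subringE(1)[OF k'] .
  let ?\<A> = "{B. \<one> \<in> B \<and> left_indep k B}"
  have "\<exists>M\<in>?\<A>. \<forall>X\<in>?\<A>. M \<subseteq> X \<longrightarrow> X = M"
  proof (rule subset_Zorn_nonempty)
    have "left_indep k {\<one>}"
      unfolding left_indep_def
    proof (intro conjI ballI impI)
      fix g assume g: "g \<in> fin_supp k {\<one>}" and 0: "lincomb g = \<zero>"
      have "g = single \<one> (g \<one>)" using fin_suppD(2)[OF g] by (auto simp: single_def)
      moreover have "g \<one> \<in> carrier R" using fin_suppD(1)[OF g] kc by auto
      ultimately have "g \<one> = \<zero>" using 0 lincomb_single[of "g \<one>" \<one>] by simp
      with \<open>g = single \<one> (g \<one>)\<close> show "g = (\<lambda>_. \<zero>)"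
        by (simp add: single_def fun_eq_iff)
    qed auto
    then show "?\<A> \<noteq> {}" by blast
  next
    fix \<C> assume ne: "\<C> \<noteq> {}" and ch: "subset.chain ?\<A> \<C>"
    have sub: "\<C> \<subseteq> ?\<A>" using ch by (auto simp: subset.chain_def)
    have "left_indep k (\<Union>\<C>)"
      unfolding left_indep_def
    proof (intro conjI ballI impI)
      show "\<Union>\<C> \<subseteq> carrier R" using sub by (auto simp: left_indep_def)
      fix g assume g: "g \<in> fin_supp k (\<Union>\<C>)" and 0: "lincomb g = \<zero>"
      \<comment> \<open>A relation involves finitely many elements, so it already lives in a member of the chain.\<close>
      obtain X where X: "X \<in> \<C>" "{b. g b \<noteq> \<zero>} \<subseteq> X"
        using finite_subset_Union_chain[OF fin_suppD(3,4)[OF g] ne ch] by blast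
      then have "g \<in> fin_supp k X" using g by (auto simp: fin_supp_def)
      with X(1) sub 0 show "g = (\<lambda>_. \<zero>)" by (auto simp: left_indep_def)
    qed
    then show "\<Union>\<C> \<in> ?\<A>" using ne sub by blast
  qed
  then obtain B where B: "\<one> \<in> B" "left_indep k B"
    and max: "\<And>X. \<one> \<in> X \<Longrightarrow> left_indep k X \<Longrightarrow> B \<subseteq> X \<Longrightarrow> X = B"
    by blast
  have Bc: "B \<subseteq> carrier R" using B by (simp add: left_indep_def)
  have "lincomb ` fin_supp k B = carrier R"
  proof
    show "lincomb ` fin_supp k B \<subseteq> carrier R"
      using lincomb_closed[OF _ Bc] fin_supp_mono[OF kc subset_refl] by blast
    show "carrier R \<subseteq> lincomb ` fin_supp k B"
    proof
      fix a assume a: "a \<in> carrier R"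
      show "a \<in> lincomb ` fin_supp k B"
        by (rule left_indep_maximal_spans[OF k B(2) _ a]) (use max B(1) in blast)
    qed
  qed
  then have "left_basis k B"
    using Bc left_indep_inj_on_lincomb[OF k' B(2)] by (simp add: left_basis_def bij_betw_def)
  with B(1) that show ?thesis by blast
qed

definition coord :: "'a set \<Rightarrow> 'a set \<Rightarrow> 'a \<Rightarrow> 'a \<Rightarrow> 'a" where
  "coord k B = inv_into (fin_supp k B) lincomb"

lemma coord_in_fin_supp:
  "left_basis k B \<Longrightarrow> a \<in> carrier R \<Longrightarrow> coord k B a \<in> fin_supp k B"
  unfolding left_basis_def coord_def by (metis bij_betw_imp_surj_on inv_into_into)

lemma lincomb_coord:
  "left_basis k B \<Longrightarrow> a \<in> carrier R \<Longrightarrow> lincomb (coord k B a) = a"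
  unfolding left_basis_def coord_def by (metis bij_betw_inv_into_right)

lemma coord_lincomb:
  "left_basis k B \<Longrightarrow> g \<in> fin_supp k B \<Longrightarrow> coord k B (lincomb g) = g"
  unfolding left_basis_def coord_def by (metis bij_betw_inv_into_left)

lemma coord_add:
  assumes k: "subring k R" and B: "left_basis k B" and a: "a \<in> carrier R" and c: "c \<in> carrier R"
  shows "coord k B (a \<oplus> c) = (\<lambda>b. coord k B a b \<oplus> coord k B c b)"
proof -
  have Bc: "B \<subseteq> carrier R" using B by (simp add: left_basis_def)
  have sub: "fin_supp k B \<subseteq> fin_supp (carrier R) B"
    using subringE(1)[OF k] by (rule fin_supp_mono) simp
  have "lincomb (\<lambda>b. coord k B a b \<oplus> coord k B c b) = a \<oplus> c"
    using lincomb_add[of "coord k B a" B "coord k B c"] coord_in_fin_supp[OF B] lincomb_coord[OF B]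
      sub a c Bc by auto
  then show ?thesis
    using coord_lincomb[OF B add_in_fin_supp[OF k coord_in_fin_supp[OF B a] coord_in_fin_supp[OF B c]]]
    by simp
qed

lemma coord_smult:
  assumes k: "subring k R" and B: "left_basis k B" and a: "a \<in> carrier R" and c: "c \<in> k"
  shows "coord k B (c \<otimes> a) = (\<lambda>b. c \<otimes> coord k B a b)"
proof -
  have Bc: "B \<subseteq> carrier R" using B by (simp add: left_basis_def)
  have kc: "k \<subseteq> carrier R" using subringE(1)[OF k] .
  have sub: "fin_supp k B \<subseteq> fin_supp (carrier R) B"
    using kc by (rule fin_supp_mono) simp
  have "lincomb (\<lambda>b. c \<otimes> coord k B a b) = c \<otimes> a"
    using lincomb_smult[of "coord k B a" B c] coord_in_fin_supp[OF B a] lincomb_coord[OF B a]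
      sub a c kc Bc by auto
  then show ?thesis
    using coord_lincomb[OF B smult_in_fin_supp[OF k c coord_in_fin_supp[OF B a]]] by simp
qed

lemma coord_basis_multiple:
  assumes k: "subring k R" and B: "left_basis k B" and b: "b \<in> B" and c: "c \<in> k"
  shows "coord k B (c \<otimes> b) = single b c"
proof -
  have "single b c \<in> fin_supp k B"
    using c b subringE(2)[OF k] by (intro single_in_fin_supp)
  moreover have "lincomb (single b c) = c \<otimes> b"
    using b c B subringE(1)[OF k] by (intro lincomb_single) (auto simp: left_basis_def)
  ultimately show ?thesis using coord_lincomb[OF B] by metis
qed


section \<open>The free module on a set\<close>

definition free_module :: "'i set \<Rightarrow> ('a, 'i \<Rightarrow> 'a) module" where
  "free_module B = \<lparr>carrier = fin_supp (carrier R) B, mult = undefined, one = undefined,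
    zero = (\<lambda>_. \<zero>), add = (\<lambda>g h b. g b \<oplus> h b), smult = (\<lambda>a g b. a \<otimes> g b)\<rparr>"

lemma left_module_free_module: "left_module R (free_module B)"
proof (intro left_module.intro left_module_axioms.intro ring_axioms)
  note closed = add_in_fin_supp[OF carrier_is_subring] smult_in_fin_supp[OF carrier_is_subring]
  show "abelian_group (free_module B)"
  proof (rule abelian_groupI)
    fix g assume "g \<in> carrier (free_module B)"
    then have g: "g \<in> fin_supp (carrier R) B" by (simp add: free_module_def)
    have "(\<lambda>b. \<ominus> \<one> \<otimes> g b) \<in> carrier (free_module B)"
      using closed(2)[OF _ g, of "\<ominus> \<one>"] by (simp add: free_module_def)
    moreover have "(\<lambda>b. \<ominus> \<one> \<otimes> g b) \<oplus>\<^bsub>free_module B\<^esub> g = \<zero>\<^bsub>free_module B\<^esub>"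
      using fin_suppD(1)[OF g] by (simp add: free_module_def l_minus l_neg)
    ultimately show "\<exists>h\<in>carrier (free_module B). h \<oplus>\<^bsub>free_module B\<^esub> g = \<zero>\<^bsub>free_module B\<^esub>"
      by blast
  qed (auto simp: free_module_def closed(1) zero_in_fin_supp fun_eq_iff a_ac
      fin_suppD(1)[where k = "carrier R" and B = B])
qed (auto simp: free_module_def smult_in_fin_supp[OF carrier_is_subring] fun_eq_iff
    l_distr r_distr m_assoc fin_suppD(1)[where k = "carrier R" and B = B])

text \<open>
  A family \<open>g\<close> is coded by a list of its support followed by the list of its values there.  Both
  halves have the same length, so the support and the values can be read off from the code.
\<close>

lemma fin_supp_encoding:
  fixes emb :: "'a list \<Rightarrow> 'm"
  assumes B: "B \<subseteq> carrier R" and emb: "inj_on emb (lists (carrier R))"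
  obtains i :: "('a \<Rightarrow> 'a) \<Rightarrow> 'm" where "inj_on i (fin_supp (carrier R) B)"
proof
  define s where "s g = (SOME xs. set xs = {b. g b \<noteq> \<zero>})" for g :: "'a \<Rightarrow> 'a"
  define enc where "enc g = s g @ map g (s g)" for g
  have s: "set (s g) = {b. g b \<noteq> \<zero>}" if "g \<in> fin_supp (carrier R) B" for g
    unfolding s_def by (rule someI_ex) (use fin_suppD(3)[OF that] finite_list in blast)
  have "inj_on enc (fin_supp (carrier R) B)"
  proof (rule inj_onI)
    fix g h
    assume g: "g \<in> fin_supp (carrier R) B" and h: "h \<in> fin_supp (carrier R) B"
      and eq: "enc g = enc h"
    have "length (s g) = length (s h)"
      using arg_cong[OF eq, of length] by (simp add: enc_def)
    with eq have *: "s g = s h" "map g (s g) = map h (s h)" by (auto simp: enc_def)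
    show "g = h"
    proof
      fix b
      show "g b = h b"
      proof (cases "b \<in> set (s g)")
        case True
        moreover have "map g (s g) = map h (s g)" using * by simp
        ultimately show ?thesis by simp
      next
        case False
        then have "b \<notin> {b. g b \<noteq> \<zero>}" "b \<notin> {b. h b \<noteq> \<zero>}"
          using *(1) unfolding s[OF g, symmetric] s[OF h, symmetric] by simp_all
        then show ?thesis by simp
      qed
    qed
  qed
  moreover have "enc ` fin_supp (carrier R) B \<subseteq> lists (carrier R)"
  proof
    fix xs assume "xs \<in> enc ` fin_supp (carrier R) B"
    then obtain g where g: "g \<in> fin_supp (carrier R) B" "xs = enc g" by blast
    have "set (s g) \<subseteq> carrier R" using s[OF g(1)] fin_suppD(4)[OF g(1)] B by simp
    moreover have "g ` set (s g) \<subseteq> carrier R" using fin_suppD(1)[OF g(1)] by blast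
    ultimately show "xs \<in> lists (carrier R)" by (simp add: g(2) enc_def lists_eq_set)
  qed
  ultimately show "inj_on (emb \<circ> enc) (fin_supp (carrier R) B)"
    by (intro comp_inj_on inj_on_subset[OF emb])
qed


section \<open>Retractions onto the linear endomorphisms of a free module\<close>

text \<open>
  The \<open>S\<close>-linear endomorphisms of the free module.  Taking \<open>S\<close> to be the whole ring or the image of
  the scalars gives the two endomorphism monoids that h-separability compares, as the next two
  lemmas say.
\<close>

definition free_endos :: "'a set \<Rightarrow> 'i set \<Rightarrow> (('i \<Rightarrow> 'a) \<Rightarrow> 'i \<Rightarrow> 'a) set" where
  "free_endos S B = {f \<in> fin_supp (carrier R) B \<rightarrow>\<^sub>E fin_supp (carrier R) B.
    (\<forall>g\<in>fin_supp (carrier R) B. \<forall>h\<in>fin_supp (carrier R) B.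
      f (\<lambda>b. g b \<oplus> h b) = (\<lambda>b. f g b \<oplus> f h b)) \<and>
    (\<forall>a\<in>S. \<forall>g\<in>fin_supp (carrier R) B. f (\<lambda>b. a \<otimes> g b) = (\<lambda>b. a \<otimes> f g b))}"

lemma mod_hom_free_module: "mod_hom R (free_module B) (free_module B) = free_endos (carrier R) B"
  by (simp add: mod_hom_def free_endos_def free_module_def)

lemma mod_hom_restrict_scalars_free_module:
  "mod_hom K (restrict_scalars u (free_module B)) (restrict_scalars u (free_module B))
    = free_endos (u ` carrier K) B"
  by (simp add: mod_hom_def free_endos_def free_module_def restrict_scalars_def)

lemma free_endos_antimono: "S \<subseteq> S' \<Longrightarrow> free_endos S' B \<subseteq> free_endos S B"
  by (auto simp: free_endos_def)

lemma single_in_free: "b \<in> B \<Longrightarrow> a \<in> carrier R \<Longrightarrow> single b a \<in> fin_supp (carrier R) B"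
  by (simp add: single_in_fin_supp)

lemma restrict_in_free_endos:
  fixes f :: "('i \<Rightarrow> 'a) \<Rightarrow> 'i \<Rightarrow> 'a"
  assumes S: "S \<subseteq> carrier R"
    and f: "\<And>g. g \<in> fin_supp (carrier R) B \<Longrightarrow> f g \<in> fin_supp (carrier R) B"
    and add: "\<And>g h. g \<in> fin_supp (carrier R) B \<Longrightarrow> h \<in> fin_supp (carrier R) B \<Longrightarrow>
      f (\<lambda>b. g b \<oplus> h b) = (\<lambda>b. f g b \<oplus> f h b)"
    and smult: "\<And>a g. a \<in> S \<Longrightarrow> g \<in> fin_supp (carrier R) B \<Longrightarrow>
      f (\<lambda>b. a \<otimes> g b) = (\<lambda>b. a \<otimes> f g b)"
  shows "restrict f (fin_supp (carrier R) B) \<in> free_endos S B"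
  unfolding free_endos_def
proof (intro CollectI conjI ballI)
  show "restrict f (fin_supp (carrier R) B) \<in> fin_supp (carrier R) B \<rightarrow>\<^sub>E fin_supp (carrier R) B"
    using f by simp
next
  fix g h :: "'i \<Rightarrow> 'a"
  assume g: "g \<in> fin_supp (carrier R) B" and h: "h \<in> fin_supp (carrier R) B"
  show "restrict f (fin_supp (carrier R) B) (\<lambda>b. g b \<oplus> h b)
      = (\<lambda>b. restrict f (fin_supp (carrier R) B) g b \<oplus> restrict f (fin_supp (carrier R) B) h b)"
    using g h add[OF g h] add_in_fin_supp[OF carrier_is_subring g h] by simp
next
  fix a and g :: "'i \<Rightarrow> 'a"
  assume a: "a \<in> S" and g: "g \<in> fin_supp (carrier R) B"
  then have "(\<lambda>b. a \<otimes> g b) \<in> fin_supp (carrier R) B"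
    using S by (intro smult_in_fin_supp carrier_is_subring) auto
  then show "restrict f (fin_supp (carrier R) B) (\<lambda>b. a \<otimes> g b)
      = (\<lambda>b. a \<otimes> restrict f (fin_supp (carrier R) B) g b)"
    using g smult[OF a g] by simp
qed

text \<open>
  All maps of the main argument, except the inclusion of coordinates, have this form: a linear
  functional placed in a single coordinate.
\<close>

lemma free_endos_coordinate_map:
  assumes b: "b \<in> B" and S: "S \<subseteq> carrier R"
    and \<phi>: "\<And>g. g \<in> fin_supp (carrier R) B \<Longrightarrow> \<phi> g \<in> carrier R"
    and add: "\<And>g h. g \<in> fin_supp (carrier R) B \<Longrightarrow> h \<in> fin_supp (carrier R) B \<Longrightarrow>
      \<phi> (\<lambda>b. g b \<oplus> h b) = \<phi> g \<oplus> \<phi> h"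
    and smult: "\<And>a g. a \<in> S \<Longrightarrow> g \<in> fin_supp (carrier R) B \<Longrightarrow> \<phi> (\<lambda>b. a \<otimes> g b) = a \<otimes> \<phi> g"
  shows "restrict (\<lambda>g. single b (\<phi> g)) (fin_supp (carrier R) B) \<in> free_endos S B"
proof (rule restrict_in_free_endos[OF S])
  fix g h a
  assume g: "g \<in> fin_supp (carrier R) B"
  show "single b (\<phi> g) \<in> fin_supp (carrier R) B" using single_in_free[OF b \<phi>[OF g]] .
  show "single b (\<phi> (\<lambda>b. g b \<oplus> h b)) = (\<lambda>x. single b (\<phi> g) x \<oplus> single b (\<phi> h) x)"
    if h: "h \<in> fin_supp (carrier R) B"
    by (simp add: add[OF g h] single_def fun_eq_iff)
  show "single b (\<phi> (\<lambda>b. a \<otimes> g b)) = (\<lambda>x. a \<otimes> single b (\<phi> g) x)" if a: "a \<in> S"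
    using a S by (auto simp: smult[OF a g] single_def fun_eq_iff)
qed

lemma free_endos_compose:
  assumes S: "S \<subseteq> carrier R" and f: "f \<in> free_endos S B" and g: "g \<in> free_endos S B"
  shows "compose (fin_supp (carrier R) B) f g \<in> free_endos S B"
proof -
  have f': "f x \<in> fin_supp (carrier R) B" if "x \<in> fin_supp (carrier R) B" for x
    using f that by (auto simp: free_endos_def)
  have g': "g x \<in> fin_supp (carrier R) B" if "x \<in> fin_supp (carrier R) B" for x
    using g that by (auto simp: free_endos_def)
  show ?thesis
    unfolding compose_def
    by (rule restrict_in_free_endos[OF S]) (use f' g' f g in \<open>simp_all add: free_endos_def\<close>)
qed

text \<open>
  The heart of the matter: a multiplicative retraction of the \<open>k\<close>-linear onto the \<open>R\<close>-linear
  endomorphisms of \<open>F\<close> preserves the nonvanishing of the rank one maps \<open>E\<^sub>c\<close>, and cannot do so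
  for \<open>c \<noteq> \<one>\<close>, where \<open>E\<^sub>c\<close> squares to zero.  All maps are realised on \<open>F\<close> itself, with \<open>R\<close>
  embedded as the coordinate at \<open>\<one>\<close>, so that one endomorphism monoid suffices.
\<close>

lemma trivial_of_endomorphism_retraction:
  assumes k: "subfield k R" and B: "left_basis k B" and one: "\<one> \<in> B"
    and P: "\<And>f. f \<in> free_endos k B \<Longrightarrow> P f \<in> free_endos (carrier R) B"
    and P_id: "\<And>f. f \<in> free_endos (carrier R) B \<Longrightarrow> P f = f"
    and P_comp: "\<And>f g. f \<in> free_endos k B \<Longrightarrow> g \<in> free_endos k B \<Longrightarrow>
      P (compose (fin_supp (carrier R) B) f g) = compose (fin_supp (carrier R) B) (P f) (P g)"
  shows "k = carrier R"
proof -
  define F where "F = fin_supp (carrier R) B"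
  note k' = subfieldE(1)[OF k]
  have kc: "k \<subseteq> carrier R" using subringE(1)[OF k'] .
  have Bc: "B \<subseteq> carrier R" using B by (simp add: left_basis_def)
  have sub: "fin_supp k B \<subseteq> F" unfolding F_def using kc by (rule fin_supp_mono) simp
  note coordF = coord_in_fin_supp[OF B]
  have coord_k: "coord k B a c \<in> k" if "a \<in> carrier R" for a c
    using fin_suppD(1)[OF coordF[OF that]] .
  have coord_c: "coord k B a c \<in> carrier R" if "a \<in> carrier R" for a c
    using coord_k[OF that] kc by blast
  have coord_F: "coord k B a \<in> F" if "a \<in> carrier R" for a
    using coordF[OF that] sub by blast
  have Fc: "g b \<in> carrier R" if "g \<in> F" for g b
    using that by (simp add: F_def fin_suppD(1)[where B = B])
  have sF: "single \<one> a \<in> F" if "a \<in> carrier R" for a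
    using that one by (simp add: F_def single_in_free)
  have s_eq [simp]: "single b a b = a" for a b by (simp add: single_def)

  define \<epsilon> where "\<epsilon> = single \<one> \<one>"
  define j where "j = restrict (\<lambda>g. coord k B (g \<one>)) F"
  define m where "m = restrict (\<lambda>g. single \<one> (lincomb g)) F"
  define p where "p b = restrict (\<lambda>g. single \<one> (g b)) F" for b
  define E where "E c d = restrict (\<lambda>g. single \<one> (coord k B (g \<one>) c \<otimes> d)) F" for c d
  have \<epsilon>F: "\<epsilon> \<in> F" by (simp add: \<epsilon>_def sF)
  have j: "j \<in> free_endos k B"
    unfolding j_def F_def
  proof (rule restrict_in_free_endos[OF kc])
    fix g h a assume g: "g \<in> fin_supp (carrier R) B"
    have g1: "g \<one> \<in> carrier R" using g Fc by (simp add: F_def)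
    show "coord k B (g \<one>) \<in> fin_supp (carrier R) B" using coordF[OF g1] sub by (auto simp: F_def)
    show "coord k B (g \<one> \<oplus> h \<one>) = (\<lambda>b. coord k B (g \<one>) b \<oplus> coord k B (h \<one>) b)"
      if h: "h \<in> fin_supp (carrier R) B"
    proof -
      have "h \<one> \<in> carrier R" using h Fc by (simp add: F_def)
      then show ?thesis by (rule coord_add[OF k' B g1])
    qed
    show "coord k B (a \<otimes> g \<one>) = (\<lambda>b. a \<otimes> coord k B (g \<one>) b)" if a: "a \<in> k"
      using coord_smult[OF k' B g1 a] .
  qed
  have m: "m \<in> free_endos (carrier R) B"
    unfolding m_def F_def
    by (rule free_endos_coordinate_map) (use one Bc lincomb_closed lincomb_add lincomb_smult in auto)
  have p: "p b \<in> free_endos (carrier R) B" for b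
    unfolding p_def F_def
    by (rule free_endos_coordinate_map) (use one Fc in \<open>auto simp: F_def\<close>)
  have E: "E c d \<in> free_endos k B" if "d \<in> carrier R" for c d
    unfolding E_def F_def
  proof (rule free_endos_coordinate_map[OF one kc])
    fix g h a assume g: "g \<in> fin_supp (carrier R) B"
    have g1: "g \<one> \<in> carrier R" using g Fc by (simp add: F_def)
    show "coord k B (g \<one>) c \<otimes> d \<in> carrier R" using coord_c[OF g1] that by simp
    show "coord k B (g \<one> \<oplus> h \<one>) c \<otimes> d = coord k B (g \<one>) c \<otimes> d \<oplus> coord k B (h \<one>) c \<otimes> d"
      if "h \<in> fin_supp (carrier R) B"
    proof -
      have "h \<one> \<in> carrier R" using that Fc by (simp add: F_def)
      then show ?thesis
        using coord_c g1 \<open>d \<in> carrier R\<close> by (simp add: coord_add[OF k' B] l_distr)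
    qed
    show "coord k B (a \<otimes> g \<one>) c \<otimes> d = a \<otimes> (coord k B (g \<one>) c \<otimes> d)" if "a \<in> k"
      using coord_c[OF g1] \<open>d \<in> carrier R\<close> that kc by (auto simp: coord_smult[OF k' B g1] m_assoc)
  qed
  have RK: "f \<in> free_endos k B" if "f \<in> free_endos (carrier R) B" for f
    using free_endos_antimono[OF kc] that by blast
  note comp = P_comp[folded F_def]
  have PF: "P f g \<in> F" if "f \<in> free_endos k B" "g \<in> F" for f g
    using P[OF that(1)] that(2) by (auto simp: free_endos_def F_def)
  have P_smult: "P f (\<lambda>b. a \<otimes> g b) = (\<lambda>b. a \<otimes> P f g b)"
    if "f \<in> free_endos k B" "a \<in> carrier R" "g \<in> F" for f a g
    using P[OF that(1)] that(2,3) by (auto simp: free_endos_def F_def)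
  have P_single: "P f (single \<one> a) = (\<lambda>b. a \<otimes> P f \<epsilon> b)"
    if "f \<in> free_endos k B" "a \<in> carrier R" for f a
  proof -
    have "single \<one> a = (\<lambda>b. a \<otimes> \<epsilon> b)" using that(2) by (auto simp: \<epsilon>_def single_def)
    then show ?thesis using P_smult[OF that \<epsilon>F] by simp
  qed

  \<comment> \<open>The separability idempotent \<open>P j \<epsilon>\<close> multiplies to \<open>\<one>\<close>, so it has a nonzero coefficient, and
    its coefficients are the values of \<open>P\<close> on the rank one maps.\<close>
  obtain b where b: "b \<in> B" "P (E b \<one>) \<epsilon> \<noteq> (\<lambda>_. \<zero>)"
  proof -
    let ?e = "P j \<epsilon>"
    have eF: "?e \<in> F" using PF[OF j \<epsilon>F] .
    have "compose F m j = p \<one>"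
      using Fc lincomb_coord[OF B] coord_F
      by (auto simp: compose_def m_def j_def p_def fun_eq_iff)
    then have "compose F m (P j) = p \<one>"
      using comp[OF RK[OF m] j] P_id[OF m] P_id[OF p] by simp
    then have "m ?e = p \<one> \<epsilon>"
      using \<epsilon>F by (metis compose_eq)
    then have "single \<one> (lincomb ?e) = \<epsilon>"
      using eF \<epsilon>F by (simp add: m_def p_def \<epsilon>_def)
    then have le: "lincomb ?e = \<one>" unfolding \<epsilon>_def by (metis s_eq)
    have "\<exists>b. ?e b \<noteq> \<zero>"
    proof (rule ccontr)
      assume "\<not> ?thesis"
      then have "?e = (\<lambda>_. \<zero>)" by auto
      then show False using le lincomb_zero subfieldE(6)[OF k] by simp
    qed
    then obtain b where b: "?e b \<noteq> \<zero>" by blast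
    then have bB: "b \<in> B" using fin_suppD(2)[OF eF[unfolded F_def]] by blast
    have "E b \<one> = compose F (p b) j"
      using Fc coord_c coord_F by (auto simp: compose_def E_def j_def p_def fun_eq_iff)
    then have "P (E b \<one>) = compose F (p b) (P j)"
      using comp[OF RK[OF p] j] P_id[OF p] by simp
    then have "P (E b \<one>) \<epsilon> \<one> = ?e b"
      using \<epsilon>F eF by (simp add: compose_eq p_def)
    with b have "P (E b \<one>) \<epsilon> \<noteq> (\<lambda>_. \<zero>)" by (simp add: fun_eq_iff) metis
    with bB that show ?thesis by blast
  qed

  have E_single: "E c d (single \<one> a) = single \<one> (coord k B a c \<otimes> d)" if "a \<in> carrier R" for c d a
    using sF[OF that] by (simp add: E_def)
  have coord_one: "coord k B a = single \<one> a" if "a \<in> k" for a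
    using coord_basis_multiple[OF k' B one that] kc that by auto

  have "c = \<one>" if c: "c \<in> B" for c
  proof (rule ccontr)
    assume c1: "c \<noteq> \<one>"
    define f where "f = E c \<one>"
    have f: "f \<in> free_endos k B" by (simp add: f_def E)
    define T where "T = P f"
    have T: "T \<in> free_endos k B" "P T = T"
      unfolding T_def using P[OF f] RK P_id by auto
    have f_eq: "f g = single \<one> (coord k B (g \<one>) c)" if "g \<in> F" for g
      using that Fc coord_c by (simp add: f_def E_def)
    have cc: "c \<in> carrier R" "b \<in> carrier R" using c b Bc by auto
    \<comment> \<open>Since \<open>f\<close> sends \<open>\<lambda> c \<epsilon>\<close> to \<open>\<lambda> \<epsilon>\<close>, every rank one map into the line of \<open>\<epsilon>\<close> factors
      through it; this transfers nonvanishing from \<open>E b \<one>\<close> to \<open>T\<close>.\<close>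
    have "E b \<one> = compose F f (E b c)"
    proof
      fix g
      show "E b \<one> g = compose F f (E b c) g"
      proof (cases "g \<in> F")
        case True
        let ?l = "coord k B (g \<one>) b"
        have l: "?l \<in> k" "?l \<in> carrier R" using coord_k coord_c Fc[OF True] by auto
        have "f (single \<one> (?l \<otimes> c)) = single \<one> ?l"
          using f_eq[OF sF, of "?l \<otimes> c"] l cc coord_basis_multiple[OF k' B c l(1)] by simp
        then show ?thesis using True l by (simp add: compose_eq E_def)
      qed (simp add: compose_def E_def)
    qed
    then have TE: "P (E b \<one>) \<epsilon> = T (P (E b c) \<epsilon>)"
      using comp[OF f E[OF cc(1), of b]] \<epsilon>F by (simp add: T_def compose_eq)
    \<comment> \<open>As \<open>f\<close> starts and ends in the coordinate at \<open>\<one>\<close>, so does \<open>T\<close>: it is right multiplication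
      by \<open>x\<close> there.\<close>
    have fp: "f = compose F f (p \<one>)" "f = compose F (p \<one>) f"
      using Fc sF coord_c by (auto simp: f_def E_def p_def compose_def fun_eq_iff)
    define x where "x = T \<epsilon> \<one>"
    have xc: "x \<in> carrier R" unfolding x_def T_def using Fc[OF PF[OF f \<epsilon>F]] .
    have "T = compose F (p \<one>) T"
      using comp[OF RK[OF p] f, of \<one>] fp(2) P_id[OF p] by (simp add: T_def)
    then have "T \<epsilon> = p \<one> (T \<epsilon>)" using \<epsilon>F by (metis compose_eq)
    then have T\<epsilon>: "T \<epsilon> = single \<one> x"
      using PF[OF f \<epsilon>F] by (simp add: p_def x_def T_def)
    have T_single: "T (single \<one> a) = single \<one> (a \<otimes> x)" if "a \<in> carrier R" for a
      using P_single[OF f that] T\<epsilon> that by (auto simp: T_def single_def fun_eq_iff)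
    have "T = compose F T (p \<one>)"
      using comp[OF f RK[OF p], of \<one>] fp(1) P_id[OF p] by (simp add: T_def)
    then have T_eq: "T g = single \<one> (g \<one> \<otimes> x)" if "g \<in> F" for g
      using that T_single[OF Fc[OF that, of \<one>]] compose_eq[OF that, of T "p \<one>"] by (simp add: p_def)
    have x0: "x \<noteq> \<zero>"
    proof
      assume "x = \<zero>"
      then have "P (E b \<one>) \<epsilon> = (\<lambda>_. \<zero>)"
        using TE T_eq[OF PF[OF E[OF cc(1)] \<epsilon>F]] Fc[OF PF[OF E[OF cc(1)] \<epsilon>F]]
        by (simp add: single_def fun_eq_iff)
      with b show False by simp
    qed
    define Z where "Z = restrict (\<lambda>g. single \<one> \<zero>) F"
    have Z: "Z \<in> free_endos (carrier R) B"
      unfolding Z_def F_def by (rule free_endos_coordinate_map) (use one in auto)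
    have "compose F f f = Z"
    proof
      fix g
      show "compose F f f g = Z g"
      proof (cases "g \<in> F")
        case True
        have l: "coord k B (g \<one>) c \<in> k" "coord k B (g \<one>) c \<in> carrier R"
          using coord_k coord_c Fc[OF True] by auto
        show ?thesis
          using True c1 f_eq[OF True] f_eq[OF sF[OF l(2)]] coord_one[OF l(1)]
          by (simp add: compose_eq Z_def) (simp add: single_def)
      qed (simp add: compose_def Z_def)
    qed
    then have TT: "compose F T T = Z"
      using comp[OF f f] P_id[OF Z] by (simp add: T_def)
    have "T (T \<epsilon>) = single \<one> \<zero>"
      using TT \<epsilon>F by (metis (no_types, lifting) Z_def compose_eq restrict_apply')
    then have "single \<one> (x \<otimes> x) = single \<one> \<zero>"
      using T\<epsilon> T_single[OF xc] by simp
    then have xx: "x \<otimes> x = \<zero>" by (metis s_eq)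
    \<comment> \<open>A nonzero coordinate of \<open>x\<close> away from \<open>\<one>\<close> would let a rank one map undo \<open>T\<close> on the line of
      \<open>\<epsilon>\<close>.  The factor \<open>inv ?y\<close> is built into the rank one map, so that the
      composite is \<open>f\<close> itself and not a scalar multiple of it.\<close>
    have coord_x: "coord k B x d = \<zero>" if d1: "d \<noteq> \<one>" for d
    proof (rule ccontr)
      let ?y = "coord k B x d"
      assume "?y \<noteq> \<zero>"
      then have "?y \<in> k - {\<zero>}" using coord_k[OF xc] by auto
      note y = subfield_m_inv[OF k this]
      have yc: "inv ?y \<in> carrier R" "?y \<in> carrier R" using y(1) kc coord_c[OF xc] by auto
      let ?E = "E d (inv ?y)"
      have "f = compose F ?E (compose F T f)"
      proof
        fix g
        show "f g = compose F ?E (compose F T f) g"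
        proof (cases "g \<in> F")
          case True
          let ?l = "coord k B (g \<one>) c"
          have l: "?l \<in> k" "?l \<in> carrier R" using coord_k coord_c Fc[OF True] by auto
          have "?E (T (f g)) = single \<one> (coord k B (?l \<otimes> x) d \<otimes> inv ?y)"
            using l xc by (simp add: f_eq[OF True] T_single E_single)
          also have "coord k B (?l \<otimes> x) d \<otimes> inv ?y = ?l"
            using l yc y by (simp add: coord_smult[OF k' B xc] m_assoc)
          finally show ?thesis using True by (simp add: compose_eq f_eq)
        qed (simp add: compose_def f_def E_def)
      qed
      moreover have TTf: "P (compose F T f) = compose F T T"
        using comp[OF T(1) f] T(2) by (simp add: T_def)
      moreover have "compose F T f \<in> free_endos k B"
        using free_endos_compose[OF kc T(1) f] by (simp add: F_def)
      ultimately have "T = compose F (P ?E) Z"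
        using comp[OF E[OF yc(1)], of "compose F T f" d] TT by (metis T_def)
      then have "T \<epsilon> = P ?E (single \<one> \<zero>)"
        using \<epsilon>F by (simp add: compose_eq Z_def)
      also have "\<dots> = (\<lambda>_. \<zero>)"
        using P_single[OF E[OF yc(1)], of \<zero>] Fc[OF PF[OF E[OF yc(1)] \<epsilon>F]] by simp
      finally show False using x0 by (simp add: x_def)
    qed
    have "coord k B x = single \<one> (coord k B x \<one>)"
      using coord_x by (auto simp: single_def)
    then have "x = coord k B x \<one>"
      using lincomb_coord[OF B xc] lincomb_single[OF coord_c[OF xc] one_closed, of \<one>] coord_c[OF xc]
      by simp
    \<comment> \<open>So \<open>x\<close> is a scalar with square zero.\<close>
    then have "x \<in> k" using coord_k[OF xc, of \<one>] by simp
    then show False using subfieldE(5)[OF k _ _ xx] x0 by simp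
  qed
  with one have B1: "B = {\<one>}" by blast
  show ?thesis
  proof
    show "carrier R \<subseteq> k"
    proof
      fix a assume a: "a \<in> carrier R"
      have "coord k B a = single \<one> (coord k B a \<one>)"
        using fin_suppD(2)[OF coordF[OF a]] B1 by (auto simp: single_def)
      then have "a = coord k B a \<one>"
        using lincomb_coord[OF B a] lincomb_single[OF coord_c[OF a] one_closed, of \<one>] coord_c[OF a]
        by simp
      then show "a \<in> k" using coord_k[OF a, of \<one>] by simp
    qed
  qed (rule kc)
qed

end


section \<open>Transport of modules along an injection\<close>

definition transport_module :: "('n \<Rightarrow> 'm) \<Rightarrow> ('r, 'n) module \<Rightarrow> ('r, 'm) module" where
  "transport_module i M = (let d = inv_into (carrier M) i in
    \<lparr>carrier = i ` carrier M, mult = undefined, one = undefined, zero = i \<zero>\<^bsub>M\<^esub>,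
      add = (\<lambda>x y. i (d x \<oplus>\<^bsub>M\<^esub> d y)), smult = (\<lambda>a x. i (a \<odot>\<^bsub>M\<^esub> d x))\<rparr>)"

lemma restrict_scalars_transport:
  "restrict_scalars u (transport_module i M) = transport_module i (restrict_scalars u M)"
  by (simp add: restrict_scalars_def transport_module_def Let_def)

lemma left_module_transport:
  fixes M :: "('r, 'n) module"
  assumes M: "left_module R M" and i: "inj_on i (carrier M)"
  shows "left_module R (transport_module i M)"
proof -
  interpret left_module R M by (rule M)
  note [simp] = inv_into_f_f[OF i]
  have "abelian_group (transport_module i M)"
    by (rule abelian_groupI)
      (auto simp: transport_module_def Let_def M.a_ac
        M.r_neg intro!: bexI[of _ "\<ominus>\<^bsub>M\<^esub> x" for x])
  moreover have "left_module_axioms R (transport_module i M)"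
    by (intro left_module_axioms.intro)
      (auto simp: transport_module_def Let_def smult_closed smult_l_distr smult_r_distr
        smult_assoc smult_one)
  ultimately show ?thesis
    by (simp add: left_module_def R.ring_axioms)
qed

text \<open>
  Conjugation by the bijection from \<open>C\<close> onto \<open>i ` C\<close>, in both directions, with results again
  extensional.
\<close>

definition conjugate :: "'n set \<Rightarrow> ('n \<Rightarrow> 'm) \<Rightarrow> ('n \<Rightarrow> 'n) \<Rightarrow> 'm \<Rightarrow> 'm" where
  "conjugate C i f = restrict (\<lambda>x. i (f (inv_into C i x))) (i ` C)"

definition unconjugate :: "'n set \<Rightarrow> ('n \<Rightarrow> 'm) \<Rightarrow> ('m \<Rightarrow> 'm) \<Rightarrow> 'n \<Rightarrow> 'n" where
  "unconjugate C i g = restrict (\<lambda>x. inv_into C i (g (i x))) C"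

lemma conjugate_mod_hom:
  fixes M :: "('r, 'n) module"
  assumes M: "left_module R M" and i: "inj_on i (carrier M)" and f: "f \<in> mod_hom R M M"
  shows "conjugate (carrier M) i f \<in> mod_hom R (transport_module i M) (transport_module i M)"
proof -
  interpret left_module R M by (rule M)
  note [simp] = inv_into_f_f[OF i]
  have "f x \<in> carrier M" if "x \<in> carrier M" for x
    using f that by (auto simp: mod_hom_def)
  then show ?thesis
    using f by (auto simp: mod_hom_def transport_module_def Let_def conjugate_def smult_closed)
qed

lemma unconjugate_mod_hom:
  fixes M :: "('r, 'n) module"
  assumes M: "left_module R M" and i: "inj_on i (carrier M)"
    and g: "g \<in> mod_hom R (transport_module i M) (transport_module i M)"
  shows "unconjugate (carrier M) i g \<in> mod_hom R M M"
proof -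
  interpret left_module R M by (rule M)
  note inv[simp] = inv_into_f_f[OF i]
  have gc: "\<exists>y\<in>carrier M. g (i x) = i y" if "x \<in> carrier M" for x
    using g that by (auto simp: mod_hom_def transport_module_def Let_def)
  have c: "inv_into (carrier M) i (g (i x)) \<in> carrier M" if "x \<in> carrier M" for x
    using gc[OF that] by auto
  have add: "g (i (x \<oplus>\<^bsub>M\<^esub> y)) = i (inv_into (carrier M) i (g (i x)) \<oplus>\<^bsub>M\<^esub> inv_into (carrier M) i (g (i y)))"
    if "x \<in> carrier M" "y \<in> carrier M" for x y
    using g that by (auto simp: mod_hom_def transport_module_def Let_def)
  have smult: "g (i (a \<odot>\<^bsub>M\<^esub> x)) = i (a \<odot>\<^bsub>M\<^esub> inv_into (carrier M) i (g (i x)))"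
    if "a \<in> carrier R" "x \<in> carrier M" for a x
    using g that by (auto simp: mod_hom_def transport_module_def Let_def)
  show ?thesis
    using c by (auto simp: mod_hom_def unconjugate_def smult_closed add smult)
qed

lemma unconjugate_conjugate:
  assumes i: "inj_on i C" and f: "f \<in> C \<rightarrow>\<^sub>E C"
  shows "unconjugate C i (conjugate C i f) = f"
proof
  fix x
  show "unconjugate C i (conjugate C i f) x = f x"
  proof (cases "x \<in> C")
    case True
    then show ?thesis
      using PiE_mem[OF f True] by (simp add: unconjugate_def conjugate_def inv_into_f_f[OF i])
  next
    case False
    then show ?thesis
      using PiE_arb[OF f False] by (simp add: unconjugate_def)
  qed
qed

lemma conjugate_compose:
  assumes i: "inj_on i C" and g: "g \<in> C \<rightarrow>\<^sub>E C"
  shows "conjugate C i (compose C f g) = compose (i ` C) (conjugate C i f) (conjugate C i g)"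
proof
  fix x
  show "conjugate C i (compose C f g) x = compose (i ` C) (conjugate C i f) (conjugate C i g) x"
  proof (cases "x \<in> i ` C")
    case True
    then obtain y where y: "x = i y" "y \<in> C" by blast
    then show ?thesis
      using PiE_mem[OF g y(2)] by (simp add: conjugate_def compose_def inv_into_f_f[OF i])
  qed (simp add: conjugate_def compose_def)
qed

lemma unconjugate_compose:
  assumes g: "g \<in> i ` C \<rightarrow>\<^sub>E i ` C"
  shows "unconjugate C i (compose (i ` C) f g) = compose C (unconjugate C i f) (unconjugate C i g)"
proof
  fix x
  show "unconjugate C i (compose (i ` C) f g) x = compose C (unconjugate C i f) (unconjugate C i g) x"
  proof (cases "x \<in> C")
    case True
    then have "g (i x) \<in> i ` C" using PiE_mem[OF g] by blast
    then show ?thesis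
      using True by (simp add: unconjugate_def compose_def f_inv_into_f inv_into_into)
  qed (simp add: unconjugate_def compose_def)
qed

text \<open>
  The maps \<open>P\<^sub>X\<^sub>,\<^sub>Y\<close> for \<open>X = Y\<close> a copy of \<open>M\<close> in the universe, conjugated back to \<open>M\<close>.  Working on one
  object turns functoriality into multiplicativity on a monoid of endomorphisms.
\<close>

lemma h_separable_endomorphism_retraction:
  fixes M :: "('a, 'n) module" and i :: "'n \<Rightarrow> 'm"
    and A :: "('a, 'x) ring_scheme" and K :: "('k, 'y) ring_scheme"
  assumes hs: "h_separable_func (Mod_cat A :: (('a, 'm) module, 'm \<Rightarrow> 'm) cat)
      (Mod_cat K :: (('k, 'm) module, 'm \<Rightarrow> 'm) cat) (restriction_func u)"
    and K: "ring K" and u: "u \<in> ring_hom K A"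
    and M: "left_module A M" and i: "inj_on i (carrier M)"
  obtains P where
    "\<And>f. f \<in> mod_hom K (restrict_scalars u M) (restrict_scalars u M) \<Longrightarrow> P f \<in> mod_hom A M M"
    "\<And>f. f \<in> mod_hom A M M \<Longrightarrow> P f = f"
    "\<And>f g. f \<in> mod_hom K (restrict_scalars u M) (restrict_scalars u M) \<Longrightarrow>
      g \<in> mod_hom K (restrict_scalars u M) (restrict_scalars u M) \<Longrightarrow>
      P (compose (carrier M) f g) = compose (carrier M) (P f) (P g)"
proof -
  let ?N = "transport_module i M" and ?C = "carrier M"
  let ?EK = "mod_hom K (restrict_scalars u M) (restrict_scalars u M)"
  let ?EK' = "mod_hom K (restrict_scalars u ?N) (restrict_scalars u ?N)"
  have N: "left_module A ?N" using M i by (rule left_module_transport)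
  have Ncar: "carrier ?N = i ` ?C" by (simp add: transport_module_def Let_def)
  have rsC: "carrier (restrict_scalars u M) = ?C" "carrier (restrict_scalars u ?N) = i ` ?C"
    by (simp_all add: restrict_scalars_def Ncar)
  obtain Q where Q: "\<And>f. f \<in> ?EK' \<Longrightarrow> Q f \<in> mod_hom A ?N ?N"
    "\<And>f. f \<in> mod_hom A ?N ?N \<Longrightarrow> Q f = f"
    "\<And>f g. g \<in> ?EK' \<Longrightarrow> f \<in> ?EK' \<Longrightarrow>
      Q (compose (i ` ?C) f g) = compose (i ` ?C) (Q f) (Q g)"
  proof -
    from hs obtain P :: "('a, 'm) module \<Rightarrow> ('a, 'm) module \<Rightarrow> ('m \<Rightarrow> 'm) \<Rightarrow> 'm \<Rightarrow> 'm" where P: "\<forall>X\<in>Ob (Mod_cat A). \<forall>Y\<in>Ob (Mod_cat A).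
        \<forall>f\<in>Hom (Mod_cat K) (obj_map (restriction_func u) X) (obj_map (restriction_func u) Y).
          P X Y f \<in> Hom (Mod_cat A) X Y"
      "\<forall>X\<in>Ob (Mod_cat A). \<forall>Y\<in>Ob (Mod_cat A). \<forall>f\<in>Hom (Mod_cat A) X Y.
          P X Y (arr_map (restriction_func u) X Y f) = f"
      "\<forall>X\<in>Ob (Mod_cat A). \<forall>Y\<in>Ob (Mod_cat A). \<forall>Z\<in>Ob (Mod_cat A).
        \<forall>g\<in>Hom (Mod_cat K) (obj_map (restriction_func u) X) (obj_map (restriction_func u) Y).
        \<forall>f\<in>Hom (Mod_cat K) (obj_map (restriction_func u) Y) (obj_map (restriction_func u) Z).
          P X Z (Comp (Mod_cat K) (obj_map (restriction_func u) X) (obj_map (restriction_func u) Y)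
              (obj_map (restriction_func u) Z) f g)
          = Comp (Mod_cat A) X Y Z (P Y Z f) (P X Y g)"
      unfolding h_separable_func_def by (elim conjE exE) (rule that; assumption)
    have ob: "?N \<in> Ob (Mod_cat A)" using N by (simp add: Mod_cat_def)
    note unfold = Mod_cat_def restriction_func_def rsC
    show ?thesis
    proof (rule that[of "P ?N ?N"])
      show "P ?N ?N f \<in> mod_hom A ?N ?N" if "f \<in> ?EK'" for f
        using P(1)[rule_format, OF ob ob, of f] that by (simp add: unfold)
      show "P ?N ?N f = f" if "f \<in> mod_hom A ?N ?N" for f
        using P(2)[rule_format, OF ob ob, of f] that by (simp add: unfold)
      show "P ?N ?N (compose (i ` ?C) f g) = compose (i ` ?C) (P ?N ?N f) (P ?N ?N g)"
        if "g \<in> ?EK'" "f \<in> ?EK'" for f g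
        using P(3)[rule_format, OF ob ob ob, of g f] that by (simp add: unfold Ncar)
    qed
  qed
  have up: "conjugate ?C i f \<in> ?EK'" if "f \<in> ?EK" for f
    using conjugate_mod_hom[of K "restrict_scalars u M" i f]
      left_module_restrict_scalars[OF K u M] i that
    by (simp add: rsC restrict_scalars_transport)
  have C: "f \<in> ?C \<rightarrow>\<^sub>E ?C" if "f \<in> ?EK" for f
    using that by (simp add: mod_hom_def rsC)
  have C': "f \<in> i ` ?C \<rightarrow>\<^sub>E i ` ?C" if "f \<in> mod_hom A ?N ?N" for f
    using that by (simp add: mod_hom_def Ncar)
  show ?thesis
  proof (rule that[of "\<lambda>f. unconjugate ?C i (Q (conjugate ?C i f))"])
    fix f assume "f \<in> ?EK"
    then show "unconjugate ?C i (Q (conjugate ?C i f)) \<in> mod_hom A M M"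
      by (intro unconjugate_mod_hom[OF M i] Q(1) up)
  next
    fix f assume f: "f \<in> mod_hom A M M"
    then have "f \<in> ?C \<rightarrow>\<^sub>E ?C" by (simp add: mod_hom_def)
    then show "unconjugate ?C i (Q (conjugate ?C i f)) = f"
      using Q(2)[OF conjugate_mod_hom[OF M i f]] i by (simp add: unconjugate_conjugate)
  next
    fix f g assume f: "f \<in> ?EK" and g: "g \<in> ?EK"
    have "Q (conjugate ?C i (compose ?C f g))
        = compose (i ` ?C) (Q (conjugate ?C i f)) (Q (conjugate ?C i g))"
      using conjugate_compose[OF i C[OF g]] Q(3)[OF up[OF g] up[OF f]] by simp
    then show "unconjugate ?C i (Q (conjugate ?C i (compose ?C f g)))
        = compose ?C (unconjugate ?C i (Q (conjugate ?C i f))) (unconjugate ?C i (Q (conjugate ?C i g)))"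
      using unconjugate_compose[OF C'[OF Q(1)[OF up[OF g]]]] by simp
  qed
qed


section \<open>h-separable algebras over a field\<close>

theorem proposition3p14:
  fixes K :: "('k, 'x) ring_scheme"
    and A :: "('k, 'a, 'c) module_scheme"
    and emb :: "'a list \<Rightarrow> 'm"
  assumes "field K"
    and "unital_algebra K A"
    and "inj_on emb (lists (carrier A))"
    and "h_separable_algebra TYPE('m) K A"
  shows "unit_map A \<in> ring_iso K A \<or> carrier A = {\<zero>\<^bsub>A\<^esub>}"
proof (cases "\<one>\<^bsub>A\<^esub> = \<zero>\<^bsub>A\<^esub>")
  interpret A: unital_algebra K A by (rule assms(2))
  case True
  then show ?thesis using A.A.carrier_one_zero by simp
next
  interpret K: field K by (rule assms(1))
  interpret A: unital_algebra K A by (rule assms(2))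
  let ?u = "unit_map A"
  let ?k = "?u ` carrier K"
  case False
  have u: "?u \<in> ring_hom K A" by (rule A.unit_map_ring_hom)
  interpret u: ring_hom_ring K A ?u
    by (rule ring_hom_ringI2[OF K.ring_axioms A.A.ring_axioms u])
  have k: "subfield ?k A" and inj: "inj_on ?u (carrier K)"
    using u.img_is_subfield[OF K.carrier_is_subfield False] by auto
  obtain B where B: "A.A.left_basis ?k B" "\<one>\<^bsub>A\<^esub> \<in> B"
    using A.A.left_basis_exists[OF k] by blast
  have "B \<subseteq> carrier A" using B(1) by (simp add: A.A.left_basis_def)
  then obtain i :: "('a \<Rightarrow> 'a) \<Rightarrow> 'm" where "inj_on i (A.A.fin_supp (carrier A) B)"
    using A.A.fin_supp_encoding[OF _ assms(3)] by blast
  then have i: "inj_on i (carrier (A.A.free_module B))"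
    by (simp add: A.A.free_module_def)
  have hs: "h_separable_func (Mod_cat A :: (('a, 'm) module, 'm \<Rightarrow> 'm) cat)
      (Mod_cat K :: (('k, 'm) module, 'm \<Rightarrow> 'm) cat) (restriction_func ?u)"
    using assms(4) by (simp add: h_separable_algebra_def)
  have FC: "carrier (A.A.free_module B) = A.A.fin_supp (carrier A) B"
    by (simp add: A.A.free_module_def)
  obtain P where P:
    "\<And>f. f \<in> A.A.free_endos ?k B \<Longrightarrow> P f \<in> A.A.free_endos (carrier A) B"
    "\<And>f. f \<in> A.A.free_endos (carrier A) B \<Longrightarrow> P f = f"
    "\<And>f g. f \<in> A.A.free_endos ?k B \<Longrightarrow> g \<in> A.A.free_endos ?k B \<Longrightarrow>
      P (compose (A.A.fin_supp (carrier A) B) f g)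
        = compose (A.A.fin_supp (carrier A) B) (P f) (P g)"
    using h_separable_endomorphism_retraction[OF hs K.ring_axioms u A.A.left_module_free_module i]
    unfolding FC A.A.mod_hom_free_module A.A.mod_hom_restrict_scalars_free_module
    by metis
  have "?k = carrier A"
    by (rule A.A.trivial_of_endomorphism_retraction[OF k B P])
  with inj u show ?thesis
    by (simp add: ring_iso_def bij_betw_def)
qed

end
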